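(* For every integer $n \ge 2$, the small rank of the semigroup ${\rm End}(B_n)$ is $r_1({\rm End}(B_n)) = 1$.
   Context: For an integer $n \ge 1$ let $[n] = \{1,\ldots,n\}$. The Brandt semigroup $(B_n,+)$ has underlying set $B_n = ([n]\times[n]) \cup \{\vartheta\}$, with operation $(i,j)+(k,l) = (i,l)$ if $j=k$ and $(i,j)+(k,l)=\vartheta$ if $j\neq k$, and $\alpha+\vartheta=\vartheta+\alpha=\vartheta$ for all $\alpha\in B_n$. ${\rm End}(B_n)$ is the semigroup, under composition of mappings, of all semigroup endomorphisms of $(B_n,+)$, i.e. all maps $f: B_n\to B_n$ with $(\alpha+\beta)f = \alpha f+\beta f$; maps are written on the right, so $fg$ means first $f$, then $g$. A subset $U$ of a semigroup $\Gamma$ is independent if $a\notin\langle U\setminus\{a\}\rangle$ for all $a\in U$, where $\langle X\rangle$ is the subsemigroup generated by $X$ (with $\langle\emptyset\rangle=\emptyset$). For a finite semigroup $\Gamma$, the small rank is $r_1(\Gamma)=\max\{k : \text{every subset } U \text{ of cardinality } k \text{ in } \Gamma \text{ is independent}\}$, where $k$ ranges over $1\le k\le|\Gamma|$. *)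

theory Defs
  imports Main "HOL-Library.FuncSet"
begin

datatype brandt = Pr nat nat | Theta

definition brandt_carrier :: "nat \<Rightarrow> brandt set" where
  "brandt_carrier n = {Pr i j | i j. i \<in> {1..n} \<and> j \<in> {1..n}} \<union> {Theta}"

fun brandt_add :: "brandt \<Rightarrow> brandt \<Rightarrow> brandt" where
  "brandt_add (Pr i j) (Pr k l) = (if j = k then Pr i l else Theta)"
| "brandt_add Theta \<beta> = Theta"
| "brandt_add \<alpha> Theta = Theta"

lemma brandt_add_closed:
  "\<alpha> \<in> brandt_carrier n \<Longrightarrow> \<beta> \<in> brandt_carrier n \<Longrightarrow> brandt_add \<alpha> \<beta> \<in> brandt_carrier n"
  by (cases \<alpha>; cases \<beta>) (simp_all add: brandt_carrier_def)

lemma brandt_add_assoc: "brandt_add (brandt_add \<alpha> \<beta>) \<gamma> = brandt_add \<alpha> (brandt_add \<beta> \<gamma>)"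
  by (cases \<alpha>; cases \<beta>; cases \<gamma>) simp_all

text \<open>Semigroups are given by a carrier set and an operation. Endomorphisms are
  extensional functions on the carrier, so that equality of functions is equality of mappings
  of the carrier and the set of endomorphisms of a finite semigroup is finite.\<close>

definition semigroup_End :: "'a set \<Rightarrow> ('a \<Rightarrow> 'a \<Rightarrow> 'a) \<Rightarrow> ('a \<Rightarrow> 'a) set" where
  "semigroup_End A m = {f \<in> A \<rightarrow>\<^sub>E A. \<forall>x\<in>A. \<forall>y\<in>A. f (m x y) = m (f x) (f y)}"

text \<open>Maps are written on the right: the product of \<open>f\<close> and \<open>g\<close> is first \<open>f\<close>, then \<open>g\<close>.\<close>

definition End_mult :: "'a set \<Rightarrow> ('a \<Rightarrow> 'a) \<Rightarrow> ('a \<Rightarrow> 'a) \<Rightarrow> ('a \<Rightarrow> 'a)" where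
  "End_mult A f g = compose A g f"

lemma End_mult_closed:
  assumes "\<And>x y. x \<in> A \<Longrightarrow> y \<in> A \<Longrightarrow> m x y \<in> A"
    and "f \<in> semigroup_End A m" "g \<in> semigroup_End A m"
  shows "End_mult A f g \<in> semigroup_End A m"
  using assms by (auto simp: semigroup_End_def End_mult_def compose_def PiE_iff)

inductive_set subsemigroup_gen :: "('a \<Rightarrow> 'a \<Rightarrow> 'a) \<Rightarrow> 'a set \<Rightarrow> 'a set"
  for m :: "'a \<Rightarrow> 'a \<Rightarrow> 'a" and X :: "'a set" where
  base: "x \<in> X \<Longrightarrow> x \<in> subsemigroup_gen m X"
| mult: "x \<in> subsemigroup_gen m X \<Longrightarrow> y \<in> subsemigroup_gen m X \<Longrightarrow> m x y \<in> subsemigroup_gen m X"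

definition independent_subset :: "('a \<Rightarrow> 'a \<Rightarrow> 'a) \<Rightarrow> 'a set \<Rightarrow> bool" where
  "independent_subset m U \<longleftrightarrow> (\<forall>a\<in>U. a \<notin> subsemigroup_gen m (U - {a}))"

text \<open>Meaningful for a finite nonempty carrier \<open>S\<close>.\<close>

definition small_rank :: "'a set \<Rightarrow> ('a \<Rightarrow> 'a \<Rightarrow> 'a) \<Rightarrow> nat" where
  "small_rank S m = Max {k \<in> {1..card S}. \<forall>U. U \<subseteq> S \<and> card U = k \<longrightarrow> independent_subset m U}"

end

theory Submission
  imports Defs "HOL-Combinatorics.Transposition"
begin

text \<open>
  Singletons are always independent, because the empty set generates nothing, so the small rank is
  at least \<open>1\<close>. It exceeds \<open>1\<close> only if all sets of some larger cardinality are independent.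
  One element that differs from its square rules this out for every cardinality \<open>k \<ge> 2\<close> at
  once: a set that contains both \<open>a\<close> and \<open>a * a\<close> is dependent, and \<open>{a, a * a}\<close> can be enlarged
  to a set of any cardinality \<open>k\<close> between \<open>2\<close> and the order of the semigroup
  (\<open>small_rank_eq_1\<close>). Hence every finite semigroup that is not a band has small rank \<open>1\<close>.

  For \<open>n \<ge> 2\<close>, the semigroup of endomorphisms of the Brandt semigroup is not a band: every
  permutation of the indices induces an automorphism, and the automorphism induced by a
  transposition is different from its square, the identity.
\<close>

lemma subsemigroup_gen_empty: "subsemigroup_gen m {} = {}"
proof -
  have False if "x \<in> subsemigroup_gen m {}" for x
    using that by induction auto
  then show ?thesis by blast
qed

lemma independent_subset_singleton: "independent_subset m {a}"
  by (simp add: independent_subset_def subsemigroup_gen_empty)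

lemma not_independent_if_square:
  assumes "a \<in> U" "m a a \<in> U" "m a a \<noteq> a"
  shows "\<not> independent_subset m U"
proof -
  have "a \<in> subsemigroup_gen m (U - {m a a})"
    using assms by (auto intro: subsemigroup_gen.base)
  then have "m a a \<in> subsemigroup_gen m (U - {m a a})"
    by (rule subsemigroup_gen.mult[of a m _ a]) fact
  then show ?thesis
    using assms(2) unfolding independent_subset_def by blast
qed

lemma small_rank_eq_1:
  assumes fin: "finite S" and a: "a \<in> S" and sq: "m a a \<in> S" and neq: "m a a \<noteq> a"
  shows "small_rank S m = 1"
proof -
  have "k = 1"
    if k: "1 \<le> k" "k \<le> card S"
      and indep: "\<And>U. U \<subseteq> S \<Longrightarrow> card U = k \<Longrightarrow> independent_subset m U" for k
  proof (rule ccontr)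
    assume "k \<noteq> 1"
    with k neq have "card {a, m a a} \<le> k" by simp
    then obtain U where "{a, m a a} \<subseteq> U" "U \<subseteq> S" "card U = k"
      using exists_subset_between[of "{a, m a a}" k S] k fin a sq by auto
    with indep neq show False
      using not_independent_if_square[of a U m] by auto
  qed
  moreover have "1 \<le> card S"
    using fin a card_gt_0_iff[of S] by auto
  moreover have "independent_subset m U" if "card U = 1" for U
    using that by (auto simp: card_1_singleton_iff independent_subset_singleton)
  ultimately have
    "{k \<in> {1..card S}. \<forall>U. U \<subseteq> S \<and> card U = k \<longrightarrow> independent_subset m U} = {1}"
    by auto
  then show ?thesis by (simp add: small_rank_def)
qed

lemma finite_brandt_carrier: "finite (brandt_carrier n)"
proof -
  have "brandt_carrier n = case_prod Pr ` ({1..n} \<times> {1..n}) \<union> {Theta}"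
    by (auto simp: brandt_carrier_def)
  then show ?thesis by simp
qed

lemma finite_semigroup_End: "finite A \<Longrightarrow> finite (semigroup_End A m)"
  by (rule finite_subset[of _ "A \<rightarrow>\<^sub>E A"]) (auto simp: semigroup_End_def intro: finite_PiE)

definition relabel :: "nat \<Rightarrow> (nat \<Rightarrow> nat) \<Rightarrow> brandt \<Rightarrow> brandt" where
  "relabel n p = (\<lambda>\<alpha>\<in>brandt_carrier n. case \<alpha> of Pr i j \<Rightarrow> Pr (p i) (p j) | Theta \<Rightarrow> Theta)"

lemma Pr_in_brandt_carrier: "Pr i j \<in> brandt_carrier n \<longleftrightarrow> i \<in> {1..n} \<and> j \<in> {1..n}"
  by (simp add: brandt_carrier_def)

lemma Theta_in_brandt_carrier: "Theta \<in> brandt_carrier n"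
  by (simp add: brandt_carrier_def)

lemma relabel_Pr: "i \<in> {1..n} \<Longrightarrow> j \<in> {1..n} \<Longrightarrow> relabel n p (Pr i j) = Pr (p i) (p j)"
  by (simp add: relabel_def Pr_in_brandt_carrier)

lemma relabel_Theta: "relabel n p Theta = Theta"
  by (simp add: relabel_def Theta_in_brandt_carrier)

lemma brandt_carrier_cases:
  assumes "\<alpha> \<in> brandt_carrier n"
  obtains i j where "\<alpha> = Pr i j" "i \<in> {1..n}" "j \<in> {1..n}" | "\<alpha> = Theta"
  using assms by (auto simp: brandt_carrier_def)

text \<open>Injectivity is what preserves products that are \<open>Theta\<close>: distinct inner indices must stay
  distinct.\<close>

lemma relabel_in_End:
  assumes inj: "inj_on p {1..n}" and closed: "p ` {1..n} \<subseteq> {1..n}"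
  shows "relabel n p \<in> semigroup_End (brandt_carrier n) brandt_add"
proof -
  have p: "p i \<in> {1..n}" if "i \<in> {1..n}" for i
    using closed that by blast
  have "relabel n p \<alpha> \<in> brandt_carrier n" if "\<alpha> \<in> brandt_carrier n" for \<alpha>
    using that
    by (cases rule: brandt_carrier_cases)
       (use p in \<open>simp_all only: relabel_Pr relabel_Theta Pr_in_brandt_carrier
          Theta_in_brandt_carrier simp_thms\<close>)
  then have "relabel n p \<in> brandt_carrier n \<rightarrow>\<^sub>E brandt_carrier n"
    by (auto simp: relabel_def)
  moreover have "relabel n p (brandt_add \<alpha> \<beta>) = brandt_add (relabel n p \<alpha>) (relabel n p \<beta>)"
    if "\<alpha> \<in> brandt_carrier n" "\<beta> \<in> brandt_carrier n" for \<alpha> \<beta>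
    using that(1)
  proof (cases rule: brandt_carrier_cases)
    case (1 i j)
    note \<alpha> = this
    from that(2) show ?thesis
    proof (cases rule: brandt_carrier_cases)
      case (1 k l)
      with \<alpha> inj have "p j = p k \<longleftrightarrow> j = k" by (auto dest: inj_onD)
      with \<alpha> 1 show ?thesis by (simp add: relabel_Pr relabel_Theta)
    next
      case 2
      with \<alpha> show ?thesis by (simp add: relabel_Pr relabel_Theta)
    qed
  next
    case 2
    then show ?thesis by (simp add: relabel_Theta)
  qed
  ultimately show ?thesis by (simp add: semigroup_End_def)
qed

lemma End_mult_relabel:
  assumes "p ` {1..n} \<subseteq> {1..n}"
  shows "End_mult (brandt_carrier n) (relabel n p) (relabel n q) = relabel n (q \<circ> p)"
proof
  fix \<alpha>
  have p: "p i \<in> {1..n}" if "i \<in> {1..n}" for i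
    using assms that by blast
  show "End_mult (brandt_carrier n) (relabel n p) (relabel n q) \<alpha> = relabel n (q \<circ> p) \<alpha>"
  proof (cases "\<alpha> \<in> brandt_carrier n")
    case True
    then have "relabel n q (relabel n p \<alpha>) = relabel n (q \<circ> p) \<alpha>"
      by (cases rule: brandt_carrier_cases)
         (use p in \<open>simp_all only: relabel_Pr relabel_Theta comp_apply\<close>)
    with True show ?thesis by (simp add: End_mult_def compose_def)
  next
    case False
    then show ?thesis by (simp add: End_mult_def compose_def relabel_def)
  qed
qed

theorem corollary1p2:
  fixes n :: nat
  assumes "n \<ge> 2"
  shows "small_rank (semigroup_End (brandt_carrier n) brandt_add) (End_mult (brandt_carrier n)) = 1"
proof (rule small_rank_eq_1)
  let ?t = "transpose 1 2 :: nat \<Rightarrow> nat"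
  have t: "?t ` {1..n} \<subseteq> {1..n}"
    using assms by (auto simp: transpose_def)
  have sq: "End_mult (brandt_carrier n) (relabel n ?t) (relabel n ?t) = relabel n id"
    by (simp only: End_mult_relabel[OF t] transpose_comp_involutory)
  show "finite (semigroup_End (brandt_carrier n) brandt_add)"
    by (rule finite_semigroup_End[OF finite_brandt_carrier])
  show "relabel n ?t \<in> semigroup_End (brandt_carrier n) brandt_add"
    by (rule relabel_in_End[OF _ t]) simp
  show "End_mult (brandt_carrier n) (relabel n ?t) (relabel n ?t)
      \<in> semigroup_End (brandt_carrier n) brandt_add"
    unfolding sq by (rule relabel_in_End) simp_all
  have "relabel n id (Pr 1 1) \<noteq> relabel n ?t (Pr 1 1)"
    using assms by (simp add: relabel_Pr)
  then show "End_mult (brandt_carrier n) (relabel n ?t) (relabel n ?t) \<noteq> relabel n ?t"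
    unfolding sq by auto
qed

end
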